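(* Let $G$ be a group acting coarsely on a coarse space $(X,\mathcal{C})$. Then for every $x_0\in X$ the map $G\to X$, $g\mapsto g\cdot x_0$, is a coarse equivalence from $(G,\mathcal{C}_l(G))$ to $(X,\mathcal{C})$.
   Context: Coarse structures. A coarse structure $\mathcal{C}$ on a set $X$ is a nonempty collection of families of subsets of $X$ (its members are called uniformly bounded families) such that: (1) if $\mathcal{B}_1\in\mathcal{C}$ and $\mathcal{B}_2$ is a family of subsets of $X$ each of whose elements consisting of more than one point is contained in some element of $\mathcal{B}_1$, then $\mathcal{B}_2\in\mathcal{C}$; (2) if $\mathcal{B}_1,\mathcal{B}_2\in\mathcal{C}$ then $\mathrm{St}(\mathcal{B}_1,\mathcal{B}_2)\in\mathcal{C}$, where $\mathrm{St}(B,\mathcal{B}_2)=B\cup\bigcup\{A\in\mathcal{B}_2: A\cap B\neq\emptyset\}$ and $\mathrm{St}(\mathcal{B}_1,\mathcal{B}_2)=\{\mathrm{St}(B,\mathcal{B}_2): B\in\mathcal{B}_1\}$. A coarse space is a set with a coarse structure. A set $B\subset X$ is bounded if $\{B\}\in\mathcal{C}$. A set $E\subset X\times X$ is controlled if $E\subset\bigcup_{B\in\mathcal{B}}B\times B$ for some $\mathcal{B}\in\mathcal{C}$. Maps. A function $f:(X,\mathcal{C}_X)\to(Y,\mathcal{C}_Y)$ is large scale uniform (bornologous) if $f(\mathcal{B})=\{f(B):B\in\mathcal{B}\}\in\mathcal{C}_Y$ for every $\mathcal{B}\in\mathcal{C}_X$; it is coarsely proper if $f^{-1}(U)$ is bounded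 for every bounded $U\subset Y$; it is coarse if it is both. Two functions $f,g:S\to(X,\mathcal{C}_X)$ are close if the family $\{\{f(s),g(s)\}\}_{s\in S}$ is uniformly bounded. A coarse function $f:X\to Y$ is a coarse equivalence if there is a coarse function $g:Y\to X$ with $f\circ g$ close to $\mathrm{id}_Y$ and $g\circ f$ close to $\mathrm{id}_X$. Groups. For a group $G$, $\mathcal{C}_l(G)$ is the left coarse structure: a family $\mathcal{B}$ is uniformly bounded iff there is a finite $F\subset G$ with $u^{-1}v\in F$ whenever $u,v$ belong to the same element of $\mathcal{B}$. (Its bounded sets are the finite sets.) Actions. An action of $G$ on $(X,\mathcal{C})$ is: by uniformly bornologous functions if for every controlled set $E$ there is a controlled set $E'$ with $(g\cdot x,g\cdot y)\in E'$ for all $(x,y)\in E$ and $g\in G$; coarsely proper if for each $x\in X$ and each bounded $U\subset X$ the set $\{g\in G: g\cdot x\in U\}$ is finite; cobounded if $X=G\cdot U$ for some bounded $U\subset X$; coarse if it is coarsely proper, cobounded, and by uniformly bornologous functions. "$G$ acts coarsely" means that the action is coarse.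
   Formalization: Adds the assumption that every two-point subset of X is bounded. It is necessary for the conclusion; without it the claim fails, e.g. for a nontrivial group translating itself when only families of singletons and empty sets are uniformly bounded. *)

theory Defs
  imports "HOL-Algebra.Group_Action"
begin

text \<open>A family of subsets of \<open>X\<close> is a term of type \<open>'a set set\<close> contained in \<open>Pow X\<close>; a coarse
  structure is a collection of such families. Actions are the library's \<^locale>\<open>group_action\<close>
  (homomorphisms into the group of bijections of the carrier set).\<close>

definition star :: "'a set \<Rightarrow> 'a set set \<Rightarrow> 'a set" where
  "star B \<A> = B \<union> \<Union>{A \<in> \<A>. A \<inter> B \<noteq> {}}"

definition star_family :: "'a set set \<Rightarrow> 'a set set \<Rightarrow> 'a set set" where
  "star_family \<B> \<A> = (\<lambda>B. star B \<A>) ` \<B>"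

definition coarse_structure :: "'a set \<Rightarrow> 'a set set set \<Rightarrow> bool" where
  "coarse_structure X \<C> \<longleftrightarrow>
     \<C> \<noteq> {} \<and>
     (\<forall>\<B>\<in>\<C>. \<B> \<subseteq> Pow X) \<and>
     (\<forall>\<B>\<in>\<C>. \<forall>\<A>. \<A> \<subseteq> Pow X \<and>
        (\<forall>A\<in>\<A>. (\<exists>x\<in>A. \<exists>y\<in>A. x \<noteq> y) \<longrightarrow> (\<exists>B\<in>\<B>. A \<subseteq> B)) \<longrightarrow> \<A> \<in> \<C>) \<and>
     (\<forall>\<B>\<in>\<C>. \<forall>\<A>\<in>\<C>. star_family \<B> \<A> \<in> \<C>)"

definition bounded_in :: "'a set set set \<Rightarrow> 'a set \<Rightarrow> bool" where
  "bounded_in \<C> B \<longleftrightarrow> {B} \<in> \<C>"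

definition controlled :: "'a set set set \<Rightarrow> ('a \<times> 'a) set \<Rightarrow> bool" where
  "controlled \<C> E \<longleftrightarrow> (\<exists>\<B>\<in>\<C>. E \<subseteq> (\<Union>B\<in>\<B>. B \<times> B))"

text \<open>The axioms above do not force two-point sets to be bounded; for instance, on every set the
  families consisting of singletons and the empty set form a coarse structure.\<close>

definition coarsely_connected :: "'a set \<Rightarrow> 'a set set set \<Rightarrow> bool" where
  "coarsely_connected X \<C> \<longleftrightarrow> (\<forall>x\<in>X. \<forall>y\<in>X. bounded_in \<C> {x, y})"

definition bornologous :: "'a set set set \<Rightarrow> 'b set set set \<Rightarrow> ('a \<Rightarrow> 'b) \<Rightarrow> bool" where
  "bornologous \<C>X \<C>Y f \<longleftrightarrow> (\<forall>\<B>\<in>\<C>X. (\<lambda>B. f ` B) ` \<B> \<in> \<C>Y)"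

definition coarsely_proper ::
  "'a set \<Rightarrow> 'a set set set \<Rightarrow> 'b set set set \<Rightarrow> ('a \<Rightarrow> 'b) \<Rightarrow> bool" where
  "coarsely_proper X \<C>X \<C>Y f \<longleftrightarrow> (\<forall>U. bounded_in \<C>Y U \<longrightarrow> bounded_in \<C>X {x \<in> X. f x \<in> U})"

definition coarse_map ::
  "'a set \<Rightarrow> 'a set set set \<Rightarrow> 'b set \<Rightarrow> 'b set set set \<Rightarrow> ('a \<Rightarrow> 'b) \<Rightarrow> bool" where
  "coarse_map X \<C>X Y \<C>Y f \<longleftrightarrow>
     f \<in> X \<rightarrow> Y \<and> bornologous \<C>X \<C>Y f \<and> coarsely_proper X \<C>X \<C>Y f"

definition close :: "'s set \<Rightarrow> 'a set set set \<Rightarrow> ('s \<Rightarrow> 'a) \<Rightarrow> ('s \<Rightarrow> 'a) \<Rightarrow> bool" where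
  "close S \<C> f g \<longleftrightarrow> (\<lambda>s. {f s, g s}) ` S \<in> \<C>"

definition coarse_equivalence ::
  "'a set \<Rightarrow> 'a set set set \<Rightarrow> 'b set \<Rightarrow> 'b set set set \<Rightarrow> ('a \<Rightarrow> 'b) \<Rightarrow> bool" where
  "coarse_equivalence X \<C>X Y \<C>Y f \<longleftrightarrow>
     coarse_map X \<C>X Y \<C>Y f \<and>
     (\<exists>g. coarse_map Y \<C>Y X \<C>X g \<and> close Y \<C>Y (f \<circ> g) id \<and> close X \<C>X (g \<circ> f) id)"

definition left_coarse_structure :: "('g, 'm) monoid_scheme \<Rightarrow> 'g set set set" where
  "left_coarse_structure G =
     {\<B>. \<B> \<subseteq> Pow (carrier G) \<and>
         (\<exists>F. finite F \<and> F \<subseteq> carrier G \<and>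
              (\<forall>B\<in>\<B>. \<forall>u\<in>B. \<forall>v\<in>B. inv\<^bsub>G\<^esub> u \<otimes>\<^bsub>G\<^esub> v \<in> F))}"

definition acts_uniformly_bornologously ::
  "('g, 'm) monoid_scheme \<Rightarrow> 'a set set set \<Rightarrow> ('g \<Rightarrow> 'a \<Rightarrow> 'a) \<Rightarrow> bool" where
  "acts_uniformly_bornologously G \<C> \<phi> \<longleftrightarrow>
     (\<forall>E. controlled \<C> E \<longrightarrow>
        (\<exists>E'. controlled \<C> E' \<and> (\<forall>(x, y)\<in>E. \<forall>g\<in>carrier G. (\<phi> g x, \<phi> g y) \<in> E')))"

definition acts_coarsely_properly ::
  "('g, 'm) monoid_scheme \<Rightarrow> 'a set \<Rightarrow> 'a set set set \<Rightarrow> ('g \<Rightarrow> 'a \<Rightarrow> 'a) \<Rightarrow> bool" where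
  "acts_coarsely_properly G X \<C> \<phi> \<longleftrightarrow>
     (\<forall>x\<in>X. \<forall>U. bounded_in \<C> U \<longrightarrow> finite {g \<in> carrier G. \<phi> g x \<in> U})"

definition acts_coboundedly ::
  "('g, 'm) monoid_scheme \<Rightarrow> 'a set \<Rightarrow> 'a set set set \<Rightarrow> ('g \<Rightarrow> 'a \<Rightarrow> 'a) \<Rightarrow> bool" where
  "acts_coboundedly G X \<C> \<phi> \<longleftrightarrow>
     (\<exists>U. bounded_in \<C> U \<and> X = (\<Union>g\<in>carrier G. \<phi> g ` U))"

definition coarse_action ::
  "('g, 'm) monoid_scheme \<Rightarrow> 'a set \<Rightarrow> 'a set set set \<Rightarrow> ('g \<Rightarrow> 'a \<Rightarrow> 'a) \<Rightarrow> bool" where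
  "coarse_action G X \<C> \<phi> \<longleftrightarrow>
     group_action G X \<phi> \<and>
     acts_coarsely_properly G X \<C> \<phi> \<and>
     acts_coboundedly G X \<C> \<phi> \<and>
     acts_uniformly_bornologously G \<C> \<phi>"

text \<open>Coarse connectedness is necessary for a space to be coarsely equivalent to a group with its
  left coarse structure, and it does not follow from having a coarse action: every group acts
  coarsely on itself by left translations when only the families of singletons and the empty set
  are uniformly bounded.\<close>

lemma coarse_equivalence_left_imp_coarsely_connected:
  assumes G: "group G" and C: "coarse_structure X \<C>"
    and f: "coarse_equivalence (carrier G) (left_coarse_structure G) X \<C> f"
  shows "coarsely_connected X \<C>"
  unfolding coarsely_connected_def bounded_in_def
proof (intro ballI)
  interpret group G by fact
  fix x y assume x: "x \<in> X" and y: "y \<in> X"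
  obtain g where g: "g \<in> X \<rightarrow> carrier G" and fg: "close X \<C> (f \<circ> g) id"
    and f1: "bornologous (left_coarse_structure G) \<C> f"
    using f unfolding coarse_equivalence_def coarse_map_def by (elim conjE exE) (rule that)
  let ?K = "(\<lambda>s. {(f \<circ> g) s, id s}) ` X"
  have K: "?K \<in> \<C>" using fg by (simp add: close_def)
  have gc: "g x \<in> carrier G" "g y \<in> carrier G" using g x y by auto
  have fin: "finite ((\<lambda>(u, v). inv\<^bsub>G\<^esub> u \<otimes>\<^bsub>G\<^esub> v) ` ({g x, g y} \<times> {g x, g y}))" (is "finite ?F")
    by (intro finite_imageI finite_cartesian_product) simp_all
  have "?F \<subseteq> carrier G" using gc by auto
  moreover have "\<forall>B\<in>{{g x, g y}}. \<forall>u\<in>B. \<forall>v\<in>B. inv\<^bsub>G\<^esub> u \<otimes>\<^bsub>G\<^esub> v \<in> ?F" by auto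
  moreover have "{{g x, g y}} \<subseteq> Pow (carrier G)" using gc by simp
  ultimately have "{{g x, g y}} \<in> left_coarse_structure G"
    unfolding left_coarse_structure_def using fin by blast
  hence "(\<lambda>B. f ` B) ` {{g x, g y}} \<in> \<C>"
    by (rule bspec[OF f1[unfolded bornologous_def]])
  hence L: "{{f (g x), f (g y)}} \<in> \<C>" by simp
  have star_closed: "star_family \<B> \<A> \<in> \<C>" if "\<B> \<in> \<C>" "\<A> \<in> \<C>" for \<B> \<A>
    using C[unfolded coarse_structure_def, THEN conjunct2, THEN conjunct2, THEN conjunct2] that
    by (meson bspec)
  have S: "{star {f (g x), f (g y)} ?K} \<in> \<C>"
    using star_closed[OF L K] by (simp add: star_family_def)
  have sub: "{x, y} \<subseteq> star {f (g x), f (g y)} ?K"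
    unfolding star_def using x y by auto
  have refine: "{A} \<in> \<C>" if "{B} \<in> \<C>" "A \<subseteq> X" "A \<subseteq> B" for A B
  proof -
    have "\<forall>\<A>. \<A> \<subseteq> Pow X \<and> (\<forall>A\<in>\<A>. (\<exists>x\<in>A. \<exists>y\<in>A. x \<noteq> y) \<longrightarrow> (\<exists>B\<in>{B}. A \<subseteq> B)) \<longrightarrow> \<A> \<in> \<C>"
      by (rule bspec[OF C[unfolded coarse_structure_def, THEN conjunct2, THEN conjunct2, THEN conjunct1] that(1)])
    from this[rule_format, of "{A}"] show ?thesis using that by simp
  qed
  show "{{x, y}} \<in> \<C>" using refine[OF S _ sub] x y by simp
qed

end

theory Submission
  imports Defs
begin

text \<open>The proof splits into a statement about coarse spaces and a statement about actions. A
  bornologous map \<open>f : X \<rightarrow> Y\<close> that \<^emph>\<open>reflects\<close> uniform boundedness (a family is uniformly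
  bounded as soon as its image is) is a coarse equivalence once it is coarsely surjective, in the
  sense that some \<open>g : Y \<rightarrow> X\<close> has \<open>f \<circ> g\<close> close to the identity: reflection turns every remaining
  claim into one about \<open>f \<circ> g\<close>, which is close to the identity
  (\<open>coarse_equivalence_if_reflecting\<close>).

  For the orbit map \<open>u \<mapsto> u \<cdot> x\<^sub>0\<close>, the identity \<open>v \<cdot> x\<^sub>0 = u \<cdot> (u\<inverse>v \<cdot> x\<^sub>0)\<close> lets one translate the pair
  \<open>(u \<cdot> x\<^sub>0, v \<cdot> x\<^sub>0)\<close> to \<open>(x\<^sub>0, u\<inverse>v \<cdot> x\<^sub>0)\<close> and back. Because the action is uniformly bornologous,
  these translations cost only a change of controlled set. Hence \<open>u \<cdot> x\<^sub>0\<close> and \<open>v \<cdot> x\<^sub>0\<close> are uniformly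
  close exactly when \<open>u\<inverse>v \<cdot> x\<^sub>0\<close> stays in a bounded set, and by coarse properness of the action and
  connectedness of \<open>X\<close> this means that \<open>u\<inverse>v\<close> stays in a finite set. Coarse surjectivity follows
  from coboundedness of the action, since \<open>x\<^sub>0\<close> can be added to a bounded set whose translates cover
  \<open>X\<close>.\<close>

section \<open>Coarse structures\<close>

lemma coarse_structure_subset:
  assumes "coarse_structure X \<C>" "\<B> \<in> \<C>" "B \<in> \<B>"
  shows "B \<subseteq> X"
proof -
  have "\<forall>\<B>\<in>\<C>. \<B> \<subseteq> Pow X"
    using assms(1) unfolding coarse_structure_def by (elim conjE)
  then show ?thesis using assms(2,3) by blast
qed

lemma coarse_structure_refine:
  assumes "coarse_structure X \<C>" and "\<B> \<in> \<C>" and "\<A> \<subseteq> Pow X"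
    and "\<And>A x y. A \<in> \<A> \<Longrightarrow> x \<in> A \<Longrightarrow> y \<in> A \<Longrightarrow> x \<noteq> y \<Longrightarrow> \<exists>B\<in>\<B>. A \<subseteq> B"
  shows "\<A> \<in> \<C>"
proof -
  have "\<forall>\<B>\<in>\<C>. \<forall>\<A>. \<A> \<subseteq> Pow X \<and>
      (\<forall>A\<in>\<A>. (\<exists>x\<in>A. \<exists>y\<in>A. x \<noteq> y) \<longrightarrow> (\<exists>B\<in>\<B>. A \<subseteq> B)) \<longrightarrow> \<A> \<in> \<C>"
    using assms(1) unfolding coarse_structure_def by (elim conjE)
  from this[rule_format, OF assms(2), of \<A>] show ?thesis
    using assms(3,4) by blast
qed

lemma coarse_structure_star_family:
  assumes "coarse_structure X \<C>" "\<B> \<in> \<C>" "\<A> \<in> \<C>"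
  shows "star_family \<B> \<A> \<in> \<C>"
proof -
  have "\<forall>\<B>\<in>\<C>. \<forall>\<A>\<in>\<C>. star_family \<B> \<A> \<in> \<C>"
    using assms(1) unfolding coarse_structure_def by (elim conjE)
  then show ?thesis using assms(2,3) by blast
qed

lemma coarse_structure_singletons:
  assumes "coarse_structure X \<C>" and "\<A> \<subseteq> (\<lambda>x. {x}) ` X"
  shows "\<A> \<in> \<C>"
proof -
  have "\<C> \<noteq> {}"
    using assms(1) unfolding coarse_structure_def by (elim conjE)
  then obtain \<B> where "\<B> \<in> \<C>" by blast
  then show ?thesis
    by (rule coarse_structure_refine[OF assms(1)]) (use assms(2) in auto)
qed

lemma bounded_in_subset:
  assumes "coarse_structure X \<C>" "bounded_in \<C> B" "A \<subseteq> B"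
  shows "bounded_in \<C> A"
proof -
  have B: "{B} \<in> \<C>" using assms(2) by (simp add: bounded_in_def)
  have "A \<subseteq> X" using coarse_structure_subset[OF assms(1) B] assms(3) by blast
  then show ?thesis
    unfolding bounded_in_def
    by (intro coarse_structure_refine[OF assms(1) B]) (use assms(3) in auto)
qed

lemma bounded_in_star:
  assumes "coarse_structure X \<C>" "bounded_in \<C> B" "\<A> \<in> \<C>"
  shows "bounded_in \<C> (star B \<A>)"
  using coarse_structure_star_family[OF assms(1) _ assms(3), of "{B}"] assms(2)
  by (simp add: bounded_in_def star_family_def)

text \<open>This is where connectedness enters: a bounded two-point set joins \<open>x\<close> to \<open>B\<close>.\<close>

lemma bounded_in_insert:
  assumes C: "coarse_structure X \<C>" and conn: "coarsely_connected X \<C>"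
    and B: "bounded_in \<C> B" and x: "x \<in> X"
  shows "bounded_in \<C> (insert x B)"
proof (cases "B = {}")
  case True
  have "bounded_in \<C> {x}"
    unfolding bounded_in_def by (rule coarse_structure_singletons[OF C]) (use x in blast)
  with True show ?thesis by simp
next
  case False
  then obtain b where b: "b \<in> B" by blast
  then have "b \<in> X"
    using coarse_structure_subset[OF C] B by (auto simp: bounded_in_def)
  with conn x have "bounded_in \<C> {x, b}" by (auto simp: coarsely_connected_def)
  then have "bounded_in \<C> (star {x, b} {B})"
    using B by (intro bounded_in_star[OF C]) (simp_all add: bounded_in_def)
  moreover have "insert x B \<subseteq> star {x, b} {B}" using b by (auto simp: star_def)
  ultimately show ?thesis by (rule bounded_in_subset[OF C])
qed

lemma finite_imp_bounded_in:
  assumes C: "coarse_structure X \<C>" and conn: "coarsely_connected X \<C>"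
    and "finite S" "S \<subseteq> X"
  shows "bounded_in \<C> S"
  using assms(3,4)
proof (induction S)
  case empty
  have "\<C> \<noteq> {}"
    using C unfolding coarse_structure_def by (elim conjE)
  then obtain \<B> where "\<B> \<in> \<C>" by blast
  then have "{{}} \<in> \<C>" by (rule coarse_structure_refine[OF C]) auto
  then show ?case by (simp add: bounded_in_def)
next
  case (insert x S)
  then show ?case by (intro bounded_in_insert[OF C conn]) auto
qed

text \<open>The pairs in \<open>E\<close> lie in members of a uniformly bounded family, but different pairs of points of
  \<open>B\<close> may lie in different members. All members meeting one fixed point of \<open>B\<close> together cover \<open>B\<close>,
  so it suffices to pass to the stars of points.\<close>

lemma uniformly_bounded_if_controlled:
  assumes C: "coarse_structure X \<C>" and E: "controlled \<C> E" and "\<B> \<subseteq> Pow X"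
    and sq: "\<And>B x y. B \<in> \<B> \<Longrightarrow> x \<in> B \<Longrightarrow> y \<in> B \<Longrightarrow> (x, y) \<in> E"
  shows "\<B> \<in> \<C>"
proof -
  obtain \<D> where \<D>: "\<D> \<in> \<C>" and E_sub: "E \<subseteq> (\<Union>D\<in>\<D>. D \<times> D)"
    using E unfolding controlled_def by blast
  have "star_family ((\<lambda>x. {x}) ` X) \<D> \<in> \<C>"
    using coarse_structure_star_family[OF C coarse_structure_singletons[OF C] \<D>] by blast
  then show ?thesis
  proof (rule coarse_structure_refine[OF C _ assms(3)])
    fix B x y assume B: "B \<in> \<B>" "x \<in> B"
    have "B \<subseteq> star {x} \<D>"
    proof
      fix z assume "z \<in> B"
      with B sq E_sub obtain D where "D \<in> \<D>" "x \<in> D" "z \<in> D" by blast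
      then show "z \<in> star {x} \<D>" unfolding star_def by blast
    qed
    moreover have "x \<in> X" using B assms(3) by blast
    ultimately show "\<exists>A\<in>star_family ((\<lambda>x. {x}) ` X) \<D>. B \<subseteq> A"
      unfolding star_family_def by blast
  qed
qed

lemma bounded_in_controlled_slice:
  assumes C: "coarse_structure X \<C>" and E: "controlled \<C> E" and x: "x \<in> X"
  shows "bounded_in \<C> {y. (x, y) \<in> E}"
proof -
  obtain \<D> where \<D>: "\<D> \<in> \<C>" and E_sub: "E \<subseteq> (\<Union>D\<in>\<D>. D \<times> D)"
    using E unfolding controlled_def by blast
  have "bounded_in \<C> {x}"
    unfolding bounded_in_def by (rule coarse_structure_singletons[OF C]) (use x in blast)
  then have "bounded_in \<C> (star {x} \<D>)" using bounded_in_star[OF C] \<D> by blast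
  moreover have "{y. (x, y) \<in> E} \<subseteq> star {x} \<D>"
  proof
    fix y assume "y \<in> {y. (x, y) \<in> E}"
    with E_sub obtain D where "D \<in> \<D>" "x \<in> D" "y \<in> D" by blast
    then show "y \<in> star {x} \<D>" unfolding star_def by blast
  qed
  ultimately show ?thesis by (rule bounded_in_subset[OF C])
qed

section \<open>Coarse equivalences from reflecting maps\<close>

text \<open>A set whose image under \<open>f \<circ> g\<close> lies in \<open>B\<close> is contained in the star of \<open>B\<close> with respect to the
  family \<open>\<K>\<close> that witnesses closeness. Applied to \<open>B = f U\<close> this gives coarse properness of \<open>g\<close>.
  Read in the other direction, \<open>f (g B)\<close> is contained in the star of \<open>B\<close>, so \<open>g\<close> is bornologous by
  reflection.\<close>

lemma coarse_equivalence_if_reflecting: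
  assumes C: "coarse_structure Y \<C>Y"
    and f: "f \<in> X \<rightarrow> Y" and f_born: "bornologous \<C>X \<C>Y f"
    and reflect: "\<And>\<B>. \<B> \<subseteq> Pow X \<Longrightarrow> (\<lambda>B. f ` B) ` \<B> \<in> \<C>Y \<Longrightarrow> \<B> \<in> \<C>X"
    and g: "g \<in> Y \<rightarrow> X" and fg: "close Y \<C>Y (f \<circ> g) id"
  shows "coarse_equivalence X \<C>X Y \<C>Y f"
proof -
  define \<K> where "\<K> = (\<lambda>y. {f (g y), y}) ` Y"
  have \<K>: "\<K> \<in> \<C>Y" using fg by (simp add: close_def \<K>_def)
  have f_proper: "coarsely_proper X \<C>X \<C>Y f"
    unfolding coarsely_proper_def
  proof (intro allI impI)
    fix U assume "bounded_in \<C>Y U"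
    then have "bounded_in \<C>Y (f ` {x \<in> X. f x \<in> U})"
      by (rule bounded_in_subset[OF C]) blast
    then show "bounded_in \<C>X {x \<in> X. f x \<in> U}"
      unfolding bounded_in_def by (intro reflect) auto
  qed
  have g_born: "bornologous \<C>Y \<C>X g"
    unfolding bornologous_def
  proof (intro ballI reflect)
    fix \<B> assume \<B>: "\<B> \<in> \<C>Y"
    have sub: "B \<subseteq> Y" if "B \<in> \<B>" for B
      using coarse_structure_subset[OF C \<B> that] .
    show "(\<lambda>B. g ` B) ` \<B> \<subseteq> Pow X" using sub g by fastforce
    show "(\<lambda>B. f ` B) ` (\<lambda>B. g ` B) ` \<B> \<in> \<C>Y"
    proof (rule coarse_structure_refine[OF C coarse_structure_star_family[OF C \<B> \<K>]])
      show "(\<lambda>B. f ` B) ` (\<lambda>B. g ` B) ` \<B> \<subseteq> Pow Y" using sub f g by fastforce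
      fix A assume "A \<in> (\<lambda>B. f ` B) ` (\<lambda>B. g ` B) ` \<B>"
      then obtain B where B: "B \<in> \<B>" and A: "A = f ` g ` B" by blast
      have "A \<subseteq> star B \<K>"
        using sub[OF B] unfolding A star_def \<K>_def by fastforce
      with B show "\<exists>A'\<in>star_family \<B> \<K>. A \<subseteq> A'" unfolding star_family_def by blast
    qed
  qed
  have g_proper: "coarsely_proper Y \<C>Y \<C>X g"
    unfolding coarsely_proper_def
  proof (intro allI impI)
    fix U assume "bounded_in \<C>X U"
    then have "bounded_in \<C>Y (f ` U)"
      using f_born[unfolded bornologous_def, THEN bspec, of "{U}"] by (simp add: bounded_in_def)
    then have "bounded_in \<C>Y (star (f ` U) \<K>)" using bounded_in_star[OF C] \<K> by blast
    then show "bounded_in \<C>Y {y \<in> Y. g y \<in> U}"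
      by (rule bounded_in_subset[OF C]) (fastforce simp: star_def \<K>_def)
  qed
  have gf: "close X \<C>X (g \<circ> f) id"
    unfolding close_def
  proof (rule reflect)
    show "(\<lambda>x. {(g \<circ> f) x, id x}) ` X \<subseteq> Pow X" using f g by auto
    \<comment> \<open>The image of \<open>{g (f x), x}\<close> under \<open>f\<close> is the member of \<open>\<K>\<close> belonging to the point \<open>f x\<close>.\<close>
    show "(\<lambda>B. f ` B) ` (\<lambda>x. {(g \<circ> f) x, id x}) ` X \<in> \<C>Y"
      by (rule coarse_structure_refine[OF C \<K>]) (use f g in \<open>auto simp: \<K>_def\<close>)
  qed
  show ?thesis
    unfolding coarse_equivalence_def coarse_map_def
    using f f_born f_proper g g_born g_proper fg gf by blast
qed

section \<open>The orbit map of a coarse action\<close>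

text \<open>The form in which uniform bornologicality of an action is used: all translates of all pairs
  from a uniformly bounded family lie in one controlled set.\<close>

lemma acts_uniformly_bornologouslyE:
  assumes "acts_uniformly_bornologously G \<C> \<phi>" and "\<B> \<in> \<C>"
  obtains E where "controlled \<C> E"
    and "\<And>B x y g. B \<in> \<B> \<Longrightarrow> x \<in> B \<Longrightarrow> y \<in> B \<Longrightarrow> g \<in> carrier G \<Longrightarrow> (\<phi> g x, \<phi> g y) \<in> E"
proof -
  have "controlled \<C> (\<Union>B\<in>\<B>. B \<times> B)"
    using assms(2) unfolding controlled_def by blast
  from assms(1)[unfolded acts_uniformly_bornologously_def, THEN spec, THEN mp, OF this]
  obtain E where E: "controlled \<C> E"
    and tr: "\<forall>(x, y)\<in>(\<Union>B\<in>\<B>. B \<times> B). \<forall>g\<in>carrier G. (\<phi> g x, \<phi> g y) \<in> E"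
    by (elim exE conjE) (rule that)
  have "(\<phi> g x, \<phi> g y) \<in> E" if "B \<in> \<B>" "x \<in> B" "y \<in> B" "g \<in> carrier G" for B x y g
  proof -
    have "(x, y) \<in> (\<Union>B\<in>\<B>. B \<times> B)" using that by blast
    from bspec[OF tr this] that(4) show ?thesis by simp
  qed
  with E show ?thesis by (rule that)
qed

lemma (in group_action) translate_by_quotient:
  assumes "u \<in> carrier G" "v \<in> carrier G" "x \<in> E"
  shows "\<phi> u (\<phi> (inv\<^bsub>G\<^esub> u \<otimes>\<^bsub>G\<^esub> v) x) = \<phi> v x"
    and "\<phi> (inv\<^bsub>G\<^esub> u) (\<phi> v x) = \<phi> (inv\<^bsub>G\<^esub> u \<otimes>\<^bsub>G\<^esub> v) x"
    and "\<phi> (inv\<^bsub>G\<^esub> u) (\<phi> u x) = x"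
proof -
  interpret group G using group_hom group_hom.axioms(1) by blast
  show "\<phi> u (\<phi> (inv\<^bsub>G\<^esub> u \<otimes>\<^bsub>G\<^esub> v) x) = \<phi> v x"
    using composition_rule[of x u "inv\<^bsub>G\<^esub> u \<otimes>\<^bsub>G\<^esub> v"] assms by (simp add: m_assoc[symmetric])
  show "\<phi> (inv\<^bsub>G\<^esub> u) (\<phi> v x) = \<phi> (inv\<^bsub>G\<^esub> u \<otimes>\<^bsub>G\<^esub> v) x"
    using composition_rule assms by simp
  show "\<phi> (inv\<^bsub>G\<^esub> u) (\<phi> u x) = x"
    using composition_rule[of x "inv\<^bsub>G\<^esub> u" u] assms id_eq_one
    by (simp add: fun_eq_iff restrict_def split: if_splits)
qed

text \<open>If \<open>u\<inverse>v\<close> ranges over a finite set \<open>F\<close>, the pair \<open>(u \<cdot> x\<^sub>0, v \<cdot> x\<^sub>0)\<close> is a translate of a pair of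
  points of the finite, hence bounded, set \<open>{x\<^sub>0} \<union> F \<cdot> x\<^sub>0\<close>.\<close>

lemma bornologous_orbit_map:
  assumes C: "coarse_structure X \<C>" and conn: "coarsely_connected X \<C>"
    and act: "group_action G X \<phi>" and born: "acts_uniformly_bornologously G \<C> \<phi>"
    and x0: "x0 \<in> X"
  shows "bornologous (left_coarse_structure G) \<C> (\<lambda>g. \<phi> g x0)"
  unfolding bornologous_def
proof
  interpret group_action G X \<phi> by fact
  fix \<B> assume "\<B> \<in> left_coarse_structure G"
  then obtain F where \<B>: "\<B> \<subseteq> Pow (carrier G)" and F: "finite F" "F \<subseteq> carrier G"
    and quot: "\<forall>B\<in>\<B>. \<forall>u\<in>B. \<forall>v\<in>B. inv\<^bsub>G\<^esub> u \<otimes>\<^bsub>G\<^esub> v \<in> F"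
    unfolding left_coarse_structure_def mem_Collect_eq by (elim conjE exE) (rule that)
  define S where "S = insert x0 ((\<lambda>h. \<phi> h x0) ` F)"
  have "S \<subseteq> X" using F(2) x0 element_image[OF _ x0 refl] by (auto simp: S_def)
  then have "{S} \<in> \<C>"
    using finite_imp_bounded_in[OF C conn] F(1) by (simp add: S_def bounded_in_def)
  then obtain E where E: "controlled \<C> E"
    and E_translate: "\<And>x y g. x \<in> S \<Longrightarrow> y \<in> S \<Longrightarrow> g \<in> carrier G \<Longrightarrow> (\<phi> g x, \<phi> g y) \<in> E"
    by (rule acts_uniformly_bornologouslyE[OF born]) blast
  show "(\<lambda>B. (\<lambda>g. \<phi> g x0) ` B) ` \<B> \<in> \<C>"
  proof (rule uniformly_bounded_if_controlled[OF C E])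
    show "(\<lambda>B. (\<lambda>g. \<phi> g x0) ` B) ` \<B> \<subseteq> Pow X"
      using \<B> element_image[OF _ x0 refl] by fastforce
    fix A x y assume "A \<in> (\<lambda>B. (\<lambda>g. \<phi> g x0) ` B) ` \<B>" "x \<in> A" "y \<in> A"
    then obtain B u v where B: "B \<in> \<B>" "u \<in> B" "v \<in> B" and xy: "x = \<phi> u x0" "y = \<phi> v x0"
      by blast
    then have uv: "u \<in> carrier G" "v \<in> carrier G" using \<B> by auto
    have "(\<phi> u x0, \<phi> u (\<phi> (inv\<^bsub>G\<^esub> u \<otimes>\<^bsub>G\<^esub> v) x0)) \<in> E"
      by (rule E_translate)
        (use bspec[OF bspec[OF bspec[OF quot B(1)] B(2)] B(3)] uv in \<open>simp_all add: S_def\<close>)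
    then show "(x, y) \<in> E" using translate_by_quotient(1)[OF uv x0] xy by simp
  qed
qed

text \<open>Translating \<open>(u \<cdot> x\<^sub>0, v \<cdot> x\<^sub>0)\<close> by \<open>u\<inverse>\<close> confines \<open>u\<inverse>v \<cdot> x\<^sub>0\<close> to a bounded set, namely the slice
  over \<open>x\<^sub>0\<close> of a controlled set; coarse properness of the action then leaves finitely many \<open>u\<inverse>v\<close>.\<close>

lemma orbit_map_reflects_uniform_boundedness:
  assumes G: "group G" and C: "coarse_structure X \<C>"
    and act: "group_action G X \<phi>" and born: "acts_uniformly_bornologously G \<C> \<phi>"
    and proper: "acts_coarsely_properly G X \<C> \<phi>" and x0: "x0 \<in> X"
    and \<B>: "\<B> \<subseteq> Pow (carrier G)" and img: "(\<lambda>B. (\<lambda>g. \<phi> g x0) ` B) ` \<B> \<in> \<C>"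
  shows "\<B> \<in> left_coarse_structure G"
proof -
  interpret group_action G X \<phi> by fact
  interpret group G by fact
  obtain E where E: "controlled \<C> E"
    and E_translate: "\<And>B u v g. B \<in> \<B> \<Longrightarrow> u \<in> B \<Longrightarrow> v \<in> B \<Longrightarrow> g \<in> carrier G \<Longrightarrow>
      (\<phi> g (\<phi> u x0), \<phi> g (\<phi> v x0)) \<in> E"
    by (rule acts_uniformly_bornologouslyE[OF born img]) blast
  define F where "F = {h \<in> carrier G. \<phi> h x0 \<in> {y. (x0, y) \<in> E}}"
  have "finite F"
    using proper x0 bounded_in_controlled_slice[OF C E x0]
    unfolding acts_coarsely_properly_def F_def by blast
  moreover have "F \<subseteq> carrier G" by (auto simp: F_def)
  moreover have "inv\<^bsub>G\<^esub> u \<otimes>\<^bsub>G\<^esub> v \<in> F" if "B \<in> \<B>" "u \<in> B" "v \<in> B" for B u v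
  proof -
    have uv: "u \<in> carrier G" "v \<in> carrier G" using that \<B> by auto
    then show ?thesis
      using E_translate[OF that, of "inv\<^bsub>G\<^esub> u"] translate_by_quotient(2,3)[OF uv x0]
      by (simp add: F_def)
  qed
  ultimately show ?thesis unfolding left_coarse_structure_def using \<B> by blast
qed

text \<open>A point \<open>x\<close> has the form \<open>g \<cdot> u\<close> with \<open>u\<close> in the fixed bounded set \<open>U\<close> whose translates cover
  \<open>X\<close>; its partner \<open>g \<cdot> x\<^sub>0\<close> in the orbit is the translate of \<open>x\<^sub>0\<close> by the same \<open>g\<close>.\<close>

lemma orbit_map_coarsely_surjective:
  assumes C: "coarse_structure X \<C>" and conn: "coarsely_connected X \<C>"
    and act: "group_action G X \<phi>" and born: "acts_uniformly_bornologously G \<C> \<phi>"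
    and cobounded: "acts_coboundedly G X \<C> \<phi>" and x0: "x0 \<in> X"
  obtains s where "s \<in> X \<rightarrow> carrier G" "close X \<C> ((\<lambda>g. \<phi> g x0) \<circ> s) id"
proof -
  interpret group_action G X \<phi> by fact
  obtain U where U: "bounded_in \<C> U" and cover: "X = (\<Union>g\<in>carrier G. \<phi> g ` U)"
    using cobounded unfolding acts_coboundedly_def by (elim exE conjE) (rule that)
  define V where "V = insert x0 U"
  have "{V} \<in> \<C>"
    using bounded_in_insert[OF C conn U x0] by (simp add: V_def bounded_in_def)
  then obtain E where E: "controlled \<C> E"
    and E_translate: "\<And>x y g. x \<in> V \<Longrightarrow> y \<in> V \<Longrightarrow> g \<in> carrier G \<Longrightarrow> (\<phi> g x, \<phi> g y) \<in> E"
    by (rule acts_uniformly_bornologouslyE[OF born]) blast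
  have "\<forall>x\<in>X. \<exists>g. g \<in> carrier G \<and> x \<in> \<phi> g ` U" using equalityD1[OF cover] by blast
  then obtain s where s: "\<And>x. x \<in> X \<Longrightarrow> s x \<in> carrier G \<and> x \<in> \<phi> (s x) ` U" by metis
  have "close X \<C> ((\<lambda>g. \<phi> g x0) \<circ> s) id"
    unfolding close_def
  proof (rule uniformly_bounded_if_controlled[OF C E])
    show "(\<lambda>x. {((\<lambda>g. \<phi> g x0) \<circ> s) x, id x}) ` X \<subseteq> Pow X"
      using s element_image[OF _ x0 refl] by fastforce
    fix A y z assume "A \<in> (\<lambda>x. {((\<lambda>g. \<phi> g x0) \<circ> s) x, id x}) ` X" "y \<in> A" "z \<in> A"
    then obtain x where x: "x \<in> X" and yz: "{y, z} \<subseteq> {\<phi> (s x) x0, x}" by auto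
    then have "{y, z} \<subseteq> \<phi> (s x) ` V" using s[OF x] by (auto simp: V_def)
    then show "(y, z) \<in> E" using E_translate s[OF x] by blast
  qed
  with s show ?thesis by (intro that[of s]) auto
qed

theorem proposition0p1:
  fixes G :: "('g, 'm) monoid_scheme"
    and X :: "'a set"
    and \<C> :: "'a set set set"
    and \<phi> :: "'g \<Rightarrow> 'a \<Rightarrow> 'a"
    and x0 :: 'a
  assumes "group G"
    and "coarse_structure X \<C>"
    and "coarsely_connected X \<C>"
    and "coarse_action G X \<C> \<phi>"
    and "x0 \<in> X"
  shows "coarse_equivalence (carrier G) (left_coarse_structure G) X \<C> (\<lambda>g. \<phi> g x0)"
proof -
  have act: "group_action G X \<phi>" and proper: "acts_coarsely_properly G X \<C> \<phi>"
    and cobounded: "acts_coboundedly G X \<C> \<phi>" and born: "acts_uniformly_bornologously G \<C> \<phi>"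
    using assms(4) unfolding coarse_action_def by blast+
  obtain s where s: "s \<in> X \<rightarrow> carrier G" "close X \<C> ((\<lambda>g. \<phi> g x0) \<circ> s) id"
    by (rule orbit_map_coarsely_surjective[OF assms(2,3) act born cobounded assms(5)])
  have "(\<lambda>g. \<phi> g x0) \<in> carrier G \<rightarrow> X"
    using group_action.element_image[OF act _ assms(5)] by auto
  then show ?thesis
    by (rule coarse_equivalence_if_reflecting[OF assms(2) _
          bornologous_orbit_map[OF assms(2,3) act born assms(5)]
          orbit_map_reflects_uniform_boundedness[OF assms(1,2) act born proper assms(5)] s])
qed

end
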